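(* Let $H=(V,E)$ be an arbitrary finite hypergraph on $n$ vertices. Then $\chi_{\mathrm{um}}(H)\le n-\lceil n/\chi_{\mathrm{cf}}(H)\rceil+1$. Moreover, this bound is best possible: for arbitrary $n$ there exists a hypergraph on $n$ vertices for which equality holds.
   Context: A hypergraph $H=(V,E)$ has a finite vertex set $V$ and a set $E$ of nonempty subsets of $V$ (hyperedges). A unique-maximum coloring of $H$ with $k$ colors is a function $C\colon V\to\{1,\dots,k\}$ such that for each $e\in E$ the maximum color among the colors of the vertices of $e$ occurs exactly once on $e$; $\chi_{\mathrm{um}}(H)$ is the minimum such $k$. A conflict-free coloring of $H$ with $k$ colors is a function $C\colon V\to\{1,\dots,k\}$ such that for each $e\in E$ some color occurs exactly once on the vertices of $e$; $\chi_{\mathrm{cf}}(H)$ is the minimum such $k$. *)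

theory Defs
  imports Complex_Main
begin

definition hypergraph :: "'a set \<Rightarrow> 'a set set \<Rightarrow> bool" where
  "hypergraph V E \<longleftrightarrow> finite V \<and> (\<forall>e\<in>E. e \<subseteq> V \<and> e \<noteq> {})"

text \<open>Only the values of a coloring on the vertex set matter; its values outside are unconstrained.\<close>

definition um_coloring :: "'a set \<Rightarrow> 'a set set \<Rightarrow> nat \<Rightarrow> ('a \<Rightarrow> nat) \<Rightarrow> bool" where
  "um_coloring V E k C \<longleftrightarrow>
     C ` V \<subseteq> {1..k} \<and> (\<forall>e\<in>E. \<exists>!v. v \<in> e \<and> C v = Max (C ` e))"

definition cf_coloring :: "'a set \<Rightarrow> 'a set set \<Rightarrow> nat \<Rightarrow> ('a \<Rightarrow> nat) \<Rightarrow> bool" where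
  "cf_coloring V E k C \<longleftrightarrow>
     C ` V \<subseteq> {1..k} \<and> (\<forall>e\<in>E. \<exists>c. \<exists>!v. v \<in> e \<and> C v = c)"

definition chi_um :: "'a set \<Rightarrow> 'a set set \<Rightarrow> nat" where
  "chi_um V E = (LEAST k. \<exists>C. um_coloring V E k C)"

definition chi_cf :: "'a set \<Rightarrow> 'a set set \<Rightarrow> nat" where
  "chi_cf V E = (LEAST k. \<exists>C. cf_coloring V E k C)"

text \<open>Both minima are attained: coloring the vertices with pairwise distinct colors is
  unique-maximum, and every unique-maximum coloring is conflict-free.\<close>

lemma um_coloring_imp_cf_coloring:
  assumes "um_coloring V E k C"
  shows "cf_coloring V E k C"
  unfolding cf_coloring_def
proof (intro conjI ballI)
  show "C ` V \<subseteq> {1..k}" using assms by (simp add: um_coloring_def)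
  show "\<exists>c. \<exists>!v. v \<in> e \<and> C v = c" if "e \<in> E" for e
    using assms that by (intro exI[of _ "Max (C ` e)"]) (simp add: um_coloring_def)
qed

lemma ex_um_coloring_card:
  assumes "hypergraph V E"
  shows "\<exists>C. um_coloring V E (card V) C"
proof -
  have fin: "finite V" and sub: "\<forall>e\<in>E. e \<subseteq> V \<and> e \<noteq> {}"
    using assms unfolding hypergraph_def by blast+
  have "card V = card {1..card V}" by simp
  from finite_same_card_bij[OF fin finite_atLeastAtMost this]
  obtain C where C: "bij_betw C V {1..card V}" by (rule exE)
  have "\<exists>!v. v \<in> e \<and> C v = Max (C ` e)" if "e \<in> E" for e
  proof -
    have e: "e \<subseteq> V" "e \<noteq> {}" using sub that by blast+
    have "Max (C ` e) \<in> C ` e"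
      using e finite_subset[OF e(1) fin] by simp
    then obtain v where v: "Max (C ` e) = C v" "v \<in> e" by (rule imageE)
    show ?thesis
    proof (rule ex1I)
      show "v \<in> e \<and> C v = Max (C ` e)" using v by simp
    next
      fix w assume "w \<in> e \<and> C w = Max (C ` e)"
      then have "C w = C v" "w \<in> e" using v(1) by simp_all
      then show "w = v"
        by (rule inj_onD[OF inj_on_subset[OF bij_betw_imp_inj_on[OF C] e(1)] _ _ v(2)])
    qed
  qed
  then have "um_coloring V E (card V) C"
    unfolding um_coloring_def by (simp add: bij_betw_imp_surj_on[OF C])
  then show ?thesis by (rule exI[where x = C])
qed

lemma chi_um_attained:
  assumes "hypergraph V E"
  shows "\<exists>C. um_coloring V E (chi_um V E) C"
  unfolding chi_um_def by (rule LeastI[where P = "\<lambda>k. \<exists>C. um_coloring V E k C"])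
    (rule ex_um_coloring_card[OF assms])

lemma chi_cf_attained:
  assumes "hypergraph V E"
  shows "\<exists>C. cf_coloring V E (chi_cf V E) C"
proof -
  from ex_um_coloring_card[OF assms]
  obtain C where "um_coloring V E (card V) C" by (rule exE)
  then have "\<exists>C. cf_coloring V E (card V) C"
    by (intro exI[where x = C] um_coloring_imp_cf_coloring)
  then show ?thesis
    unfolding chi_cf_def by (rule LeastI[where P = "\<lambda>k. \<exists>C. cf_coloring V E k C"])
qed

end

(* Take an optimal conflict-free coloring and keep only its largest color class A, which has at least
   n / chi_cf vertices by the pigeonhole principle. Color A with 1 and the remaining vertices
   injectively with larger colors. An edge leaving A has a unique maximum, and an edge inside A is
   monochromatic for the conflict-free coloring, hence a singleton. For sharpness take all nonempty
   subsets as edges: then both chromatic numbers are n. *)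
theory Submission imports Defs begin

text \<open>Trades \<open>Max\<close> for strict comparisons between vertices. These carry over from
  \<open>e - A\<close> to \<open>e\<close> vertex by vertex, with no maximum to recompute.\<close>

lemma unique_Max_iff:
  fixes C :: "'a \<Rightarrow> nat"
  assumes "finite e" "e \<noteq> {}"
  shows "(\<exists>!v. v \<in> e \<and> C v = Max (C ` e)) \<longleftrightarrow> (\<exists>v\<in>e. \<forall>w\<in>e - {v}. C w < C v)"
proof
  assume "\<exists>!v. v \<in> e \<and> C v = Max (C ` e)"
  then obtain v where v: "v \<in> e" "C v = Max (C ` e)"
    and uniq: "\<And>w. w \<in> e \<Longrightarrow> C w = Max (C ` e) \<Longrightarrow> w = v"
    by metis
  have "C w < C v" if "w \<in> e - {v}" for w
  proof (rule le_neq_implies_less)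
    show "C w \<le> C v" using that v(2) assms(1) by simp
    show "C w \<noteq> C v" using that uniq[of w] unfolding v(2) by blast
  qed
  with v show "\<exists>v\<in>e. \<forall>w\<in>e - {v}. C w < C v" by blast
next
  assume "\<exists>v\<in>e. \<forall>w\<in>e - {v}. C w < C v"
  then obtain v where v: "v \<in> e" and less: "\<And>w. w \<in> e - {v} \<Longrightarrow> C w < C v"
    by blast
  have "C w \<le> C v" if "w \<in> e" for w
    using that less[of w] by (cases "w = v") auto
  then have "Max (C ` e) = C v"
    using v assms by (intro Max_eqI) auto
  then show "\<exists>!v. v \<in> e \<and> C v = Max (C ` e)"
  proof (intro ex1I[of _ v])
    show "w = v" if "w \<in> e \<and> C w = Max (C ` e)" for w
      using that less[of w] \<open>Max (C ` e) = C v\<close> by (cases "w = v") auto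
  qed (simp add: v)
qed

lemma chi_um_le: "um_coloring V E k C \<Longrightarrow> chi_um V E \<le> k"
  unfolding chi_um_def by (blast intro: Least_le)

lemma chi_cf_le: "cf_coloring V E k C \<Longrightarrow> chi_cf V E \<le> k"
  unfolding chi_cf_def by (blast intro: Least_le)

lemma chi_um_le_card: "hypergraph V E \<Longrightarrow> chi_um V E \<le> card V"
  using ex_um_coloring_card chi_um_le by blast

lemma chi_cf_le_chi_um: "hypergraph V E \<Longrightarrow> chi_cf V E \<le> chi_um V E"
  using chi_um_attained um_coloring_imp_cf_coloring chi_cf_le by blast

lemma chi_um_le_card_Diff:
  assumes H: "hypergraph V E"
    and A: "\<And>e. e \<in> E \<Longrightarrow> e \<subseteq> A \<Longrightarrow> is_singleton e"
  shows "chi_um V E \<le> Suc (card (V - A))"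
proof -
  have fin: "finite V" and sub: "\<And>e. e \<in> E \<Longrightarrow> e \<subseteq> V \<and> e \<noteq> {}"
    using H unfolding hypergraph_def by blast+
  \<comment> \<open>The traces of the edges outside \<open>A\<close>. Edges inside \<open>A\<close>
    leave an empty trace, which a hypergraph forbids.\<close>
  define F where "F = (\<lambda>e. e - A) ` E - {{}}"
  have "hypergraph (V - A) F"
    using fin sub unfolding hypergraph_def F_def by blast
  from ex_um_coloring_card[OF this]
  obtain g where g: "um_coloring (V - A) F (card (V - A)) g" by blast
  \<comment> \<open>Since \<open>g\<close> starts at 1 on \<open>V - A\<close>, the shift by
    \<open>Suc\<close> lifts every vertex of \<open>V - A\<close> strictly above the color 1 of
    \<open>A\<close>, at the cost of one extra color.\<close>
  define C where "C v = (if v \<in> A then 1 else Suc (g v))" for v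
  have g_bounds: "1 \<le> g v" "g v \<le> card (V - A)" if "v \<in> V - A" for v
    using g that unfolding um_coloring_def by auto
  have "\<exists>!v. v \<in> e \<and> C v = Max (C ` e)" if "e \<in> E" for e
  proof -
    have e: "finite e" "e \<noteq> {}" "e \<subseteq> V"
      using sub[OF that] finite_subset[OF _ fin] by auto
    have "\<exists>v\<in>e. \<forall>w\<in>e - {v}. C w < C v"
    proof (cases "e \<subseteq> A")
      case True
      then show ?thesis using A[OF that] by (auto elim: is_singletonE)
    next
      case False
      then have "e - A \<in> F" using that by (auto simp: F_def)
      then have "\<exists>v\<in>e - A. \<forall>w\<in>e - A - {v}. g w < g v"
        using g e False unique_Max_iff[of "e - A" g] by (auto simp: um_coloring_def)
      then obtain v where v: "v \<in> e - A" "\<And>w. w \<in> e - A - {v} \<Longrightarrow> g w < g v" by blast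
      \<comment> \<open>A vertex \<open>w\<close> in \<open>A\<close> loses because
        \<open>1 < Suc (g v)\<close>; any other \<open>w\<close> loses by the choice of
        \<open>v\<close>.\<close>
      have "C w < C v" if "w \<in> e - {v}" for w
        using that v g_bounds(1)[of v] e(3) by (auto simp: C_def)
      then show ?thesis using v(1) by blast
    qed
    then show ?thesis by (simp only: unique_Max_iff[OF e(1,2)])
  qed
  moreover have "C ` V \<subseteq> {1..Suc (card (V - A))}"
    using g_bounds by (auto simp: C_def)
  ultimately have "um_coloring V E (Suc (card (V - A))) C"
    by (simp add: um_coloring_def)
  then show ?thesis by (rule chi_um_le)
qed

text \<open>\<open>A\<close> is a largest color class. The product form of the pigeonhole bound
  stays within the naturals.\<close>

lemma cf_coloring_large_class:
  assumes "finite V" "V \<noteq> {}" "cf_coloring V E k C"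
  obtains A where "A \<subseteq> V" "card V \<le> k * card A"
    "\<And>e. e \<in> E \<Longrightarrow> e \<subseteq> A \<Longrightarrow> is_singleton e"
proof -
  define B where "B c = {v \<in> V. C v = c}" for c
  have CV: "C ` V \<subseteq> {1..k}" and cf: "\<And>e. e \<in> E \<Longrightarrow> \<exists>c. \<exists>!v. v \<in> e \<and> C v = c"
    using assms(3) unfolding cf_coloring_def by blast+
  have "(\<Union>c\<in>{1..k}. B c) = V" using CV by (auto simp: B_def)
  then have card_le: "card V \<le> (\<Sum>c\<in>{1..k}. card (B c))"
    using card_UN_le[of "{1..k}" B] by simp
  have "\<exists>c. card V \<le> k * card (B c)"
  proof -
    define m where "m = Max ((\<lambda>c. card (B c)) ` {1..k})"
    \<comment> \<open>A vertex exists and has a color, so \<open>m\<close> is a maximum over a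
      nonempty set and some class attains it.\<close>
    have "{1..k} \<noteq> {}" using CV assms(2) by blast
    then have "m \<in> (\<lambda>c. card (B c)) ` {1..k}" unfolding m_def by (intro Max_in) auto
    then obtain c where c: "m = card (B c)" by blast
    have "(\<Sum>c\<in>{1..k}. card (B c)) \<le> card {1..k} * m"
      using sum_bounded_above[of "{1..k}" "\<lambda>c. card (B c)" m] by (simp add: m_def)
    with card_le have "card V \<le> k * m" by simp
    then show ?thesis unfolding c by blast
  qed
  then obtain c where c: "card V \<le> k * card (B c)" by blast
  show thesis
  proof (rule that[OF _ c])
    show "B c \<subseteq> V" by (auto simp: B_def)
    fix e assume "e \<in> E" "e \<subseteq> B c"
    moreover obtain d v where "v \<in> e" "C v = d" "\<And>w. w \<in> e \<Longrightarrow> C w = d \<Longrightarrow> w = v"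
      using cf[OF \<open>e \<in> E\<close>] by blast
    \<comment> \<open>All of \<open>e\<close> has color \<open>c\<close>, in particular
      \<open>v\<close>, so \<open>d = c\<close> and uniqueness of \<open>v\<close> applies to every
      vertex of \<open>e\<close>.\<close>
    ultimately have "e = {v}" unfolding B_def by blast
    then show "is_singleton e" by simp
  qed
qed

lemma chi_um_upper_bound:
  assumes H: "hypergraph V E"
  shows "int (chi_um V E) \<le> int (card V) - \<lceil>real (card V) / real (chi_cf V E)\<rceil> + 1"
proof (cases "V = {}")
  case True
  \<comment> \<open>Here \<open>chi_um V E\<close> is 0 and the quotient has numerator 0, so the
    bound reads 0 \<le> 1.\<close>
  then show ?thesis using chi_um_le_card[OF H] by simp
next
  case False
  have fin: "finite V" using H by (simp add: hypergraph_def)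
  define k where "k = chi_cf V E"
  obtain C where "cf_coloring V E k C" using chi_cf_attained[OF H] k_def by blast
  with fin False obtain A where A: "A \<subseteq> V" "card V \<le> k * card A"
    "\<And>e. e \<in> E \<Longrightarrow> e \<subseteq> A \<Longrightarrow> is_singleton e"
    using cf_coloring_large_class by metis
  \<comment> \<open>With \<open>k = 0\<close> the pigeonhole bound would give
    \<open>card V = 0\<close>.\<close>
  have "k > 0" using A(2) fin False by (cases k) auto
  moreover have "real (card V) \<le> real k * real (card A)"
    using A(2) by (metis of_nat_le_iff of_nat_mult)
  ultimately have "real (card V) / real k \<le> real (card A)"
    by (simp add: divide_le_eq mult.commute)
  then have "\<lceil>real (card V) / real k\<rceil> \<le> int (card A)" by (simp add: ceiling_le_iff)
  moreover have "int (chi_um V E) \<le> int (card V) - int (card A) + 1"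
  proof -
    have "card A \<le> card V" using card_mono[OF fin A(1)] .
    moreover have "chi_um V E \<le> Suc (card (V - A))"
      using H A(3) by (rule chi_um_le_card_Diff)
    moreover have "card (V - A) = card V - card A"
      using A(1) fin by (simp add: card_Diff_subset finite_subset)
    ultimately show ?thesis by linarith
  qed
  ultimately show ?thesis unfolding k_def by linarith
qed

text \<open>Edges with two vertices force a conflict-free coloring to be injective, so
  \<open>card V\<close> \<le> \<open>chi_cf\<close> \<le> \<open>chi_um\<close> \<le>
  \<open>card V\<close>.\<close>

lemma chi_complete:
  assumes "finite V"
  shows "chi_cf V (Pow V - {{}}) = card V" "chi_um V (Pow V - {{}}) = card V"
proof -
  let ?E = "Pow V - {{}}"
  have H: "hypergraph V ?E" using assms by (auto simp: hypergraph_def)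
  obtain C where C: "cf_coloring V ?E (chi_cf V ?E) C" using chi_cf_attained[OF H] by blast
  then have cf: "\<And>e. e \<in> ?E \<Longrightarrow> \<exists>c. \<exists>!v. v \<in> e \<and> C v = c"
    unfolding cf_coloring_def by blast
  have "inj_on C V"
  proof (rule inj_onI)
    fix u v assume uv: "u \<in> V" "v \<in> V" "C u = C v"
    then have "{u, v} \<in> ?E" by simp
    then obtain c x where x: "x \<in> {u, v}" "C x = c"
      and uniq: "\<And>w. w \<in> {u, v} \<Longrightarrow> C w = c \<Longrightarrow> w = x"
      using cf[of "{u, v}"] by blast
    \<comment> \<open>The color \<open>c\<close> that occurs once sits on \<open>u\<close> or
      \<open>v\<close>; as their colors agree, it sits on both.\<close>
    have "C u = c" "C v = c" using x uv(3) by (elim insertE; simp)+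
    then show "u = v" using uniq[of u] uniq[of v] by simp
  qed
  then have "card V \<le> card {1..chi_cf V ?E}"
    using C by (intro card_inj_on_le[of C]) (auto simp: cf_coloring_def)
  then show "chi_cf V ?E = card V" "chi_um V ?E = card V"
    using chi_cf_le_chi_um[OF H] chi_um_le_card[OF H] by simp_all
qed

theorem theorem1:
  "(\<forall>(V :: 'a set) E. hypergraph V E \<longrightarrow>
      int (chi_um V E) \<le> int (card V) - \<lceil>real (card V) / real (chi_cf V E)\<rceil> + 1)
   \<and> (\<forall>n::nat. n \<ge> 1 \<longrightarrow>
      (\<exists>(V :: nat set) E. hypergraph V E \<and> card V = n \<and>
         int (chi_um V E) = int n - \<lceil>real n / real (chi_cf V E)\<rceil> + 1))"
proof (intro conjI allI impI)
  fix V :: "'a set" and E assume "hypergraph V E"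
  then show "int (chi_um V E) \<le> int (card V) - \<lceil>real (card V) / real (chi_cf V E)\<rceil> + 1"
    by (rule chi_um_upper_bound)
next
  fix n :: nat assume "n \<ge> 1"
  then show "\<exists>(V :: nat set) E. hypergraph V E \<and> card V = n \<and>
      int (chi_um V E) = int n - \<lceil>real n / real (chi_cf V E)\<rceil> + 1"
    \<comment> \<open>Both chromatic numbers are \<open>n\<close>, and \<open>n / n = 1\<close>
      because \<open>n\<close> is positive, so the right side is n - 1 + 1. For \<open>n = 0\<close>
      the convention \<open>0 / 0 = 0\<close> would make it 1.\<close>
    by (intro exI[of _ "{..<n}"] exI[of _ "Pow {..<n} - {{}}"])
      (auto simp: hypergraph_def chi_complete)
qed

end
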